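(* Let $p>3$ be a prime, and for $c,d\in\mathbb{Z}$ let $D_p^-(c,d)=\det\left[(i^2+cij+dj^2)^{p-2}\right]_{1<i,j<p-1}$. Then: (i) if $p\equiv 7\pmod 8$, then $p\mid D_p^-(2,2)$; (ii) if $p>5$ and $p\equiv 2\pmod 3$, then $p\mid D_p^-(3,3)$; (iii) if $p\equiv 3\pmod{20}$ or $p\equiv 7\pmod{20}$, then $p\mid D_p^-(3,1)$.
   Context: For a prime $p>3$ and integers $c,d$, $D_p^-(c,d)$ denotes the determinant of the $(p-3)\times(p-3)$ integer matrix whose rows and columns are indexed by the integers $i,j$ with $1<i<p-1$ and $1<j<p-1$ (that is, $i,j\in\{2,3,\ldots,p-2\}$), and whose $(i,j)$ entry is the integer $(i^2+cij+dj^2)^{p-2}$. *)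

theory Defs
  imports "Jordan_Normal_Form.Determinant" "HOL-Computational_Algebra.Primes"
begin

text \<open>Matrices of \<^theory>\<open>Jordan_Normal_Form.Matrix\<close> are indexed from 0, so position \<open>(a, b)\<close>
  of the \<open>(p - 3) \<times> (p - 3)\<close> matrix below carries the entry for \<open>i = a + 2\<close>, \<open>j = b + 2\<close>;
  thus \<open>i\<close> and \<open>j\<close> run through \<open>2, \<dots>, p - 2\<close>. The subtractions are on natural numbers
  and are meant for \<open>p > 3\<close>.\<close>

definition Dp_minus_mat :: "nat \<Rightarrow> int \<Rightarrow> int \<Rightarrow> int mat" where
  "Dp_minus_mat p c d = mat (p - 3) (p - 3)
     (\<lambda>(a, b). let i = int (a + 2); j = int (b + 2) in (i\<^sup>2 + c * i * j + d * j\<^sup>2) ^ (p - 2))"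

definition Dp_minus :: "nat \<Rightarrow> int \<Rightarrow> int \<Rightarrow> int" where
  "Dp_minus p c d = det (Dp_minus_mat p c d)"

end

theory Submission
  imports Defs "HOL-Number_Theory.Number_Theory"
begin

text \<open>Modulo \<open>p\<close>, row \<open>i\<close> of the full matrix over \<open>1 \<le> i, j \<le> p - 1\<close> applied to the character
  \<open>j \<mapsto> j^m\<close> is a multiple of \<open>S m = \<Sum>j. j^m / (1 + c j + d j\<^sup>2)\<close>. If \<open>S k = S l = 0\<close> with \<open>k \<equiv> l\<close>
  modulo 2, then \<open>j^k - j^l\<close> vanishes at \<open>\<plusminus>1\<close> and lies in the kernel, so the determinant with the
  indices \<open>\<plusminus>1\<close> removed is 0. When the quadratic has no root, \<open>S\<close> satisfies the recurrence
  \<open>d S (m + 2) + c S (m + 1) + S m = 0\<close> for \<open>0 < m < p - 1\<close>, and \<open>j \<mapsto> 1 / (d j)\<close> gives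
  \<open>d^(m - 1) S m = S (p + 1 - m)\<close>. Put \<open>h = (p + 1) / 2\<close>. For \<open>(c, d) = (2, 2)\<close> the zeros are \<open>h \<plusminus> 2\<close>
  or \<open>h, h + 4\<close>, and for \<open>(3, 3)\<close> they are \<open>h \<plusminus> 3\<close> or \<open>h, h + 6\<close>, according to whether \<open>d\<close> is a square
  modulo \<open>p\<close>. For \<open>(3, 1)\<close>, \<open>2 S (h + n) = (-1)^n L (2 n) S h\<close> with Lucas numbers \<open>L\<close>, and
  \<open>L h \<equiv> 0\<close> gives the zeros \<open>h / 2\<close> and \<open>3 h / 2\<close>.\<close>

section \<open>Power sums and reindexing modulo a prime\<close>

lemma fermat_theorem_int:
  fixes a :: int
  assumes "prime p" "\<not> int p dvd a"
  shows "[a ^ (p - 1) = 1] (mod int p)"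
proof -
  define b where "b = nat (a mod int p)"
  have p0: "int p > 0" using prime_gt_0_nat[OF assms(1)] by simp
  have b: "int b = a mod int p" using p0 by (simp add: b_def)
  have "\<not> int p dvd int b" using assms(2) by (simp add: b dvd_mod_iff)
  hence "\<not> p dvd b" by simp
  from fermat_theorem[OF assms(1) this] have "[int b ^ (p - 1) = 1] (mod int p)"
    by (metis cong_int_iff of_nat_1 of_nat_power)
  moreover have "[a = int b] (mod int p)" by (simp add: b cong_def)
  ultimately show ?thesis using cong_pow cong_trans by blast
qed

lemma fermat_inverse_int:
  fixes a :: int
  assumes "prime p" "\<not> int p dvd a"
  shows "[a * a ^ (p - 2) = 1] (mod int p)"
proof -
  have "a * a ^ (p - 2) = a ^ (p - 1)"
    using prime_gt_1_nat[OF assms(1)] by (metis Suc_1 Suc_diff_Suc diff_Suc_1 power_Suc One_nat_def)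
  thus ?thesis using fermat_theorem_int[OF assms] by simp
qed

lemma cong_cancel_prime_int:
  fixes a x y :: int
  assumes "prime p" "\<not> int p dvd a" "[a * x = a * y] (mod int p)"
  shows "[x = y] (mod int p)"
proof -
  have "int p dvd a * (x - y)"
    using assms(3) by (simp add: cong_iff_dvd_diff algebra_simps)
  moreover have "prime (int p)" using assms(1) by simp
  ultimately have "int p dvd x - y"
    using assms(2) prime_dvd_mult_iff by blast
  thus ?thesis by (simp add: cong_iff_dvd_diff)
qed

lemma not_dvd_units:
  assumes "j \<in> {1..<int p}"
  shows "\<not> int p dvd j"
  using assms zdvd_not_zless by auto

text \<open>Reduced modulo \<open>p\<close>, \<open>h\<close> is an injective self-map of the finite
  set of units, hence a permutation of it, and \<open>f\<close> only sees residues.\<close>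

lemma sum_units_reindex:
  fixes f h :: "int \<Rightarrow> int"
  assumes p: "prime p"
    and f: "\<And>x y. [x = y] (mod int p) \<Longrightarrow> [f x = f y] (mod int p)"
    and h: "\<And>j. j \<in> {1..<int p} \<Longrightarrow> \<not> int p dvd h j"
    and inj: "\<And>i j. i \<in> {1..<int p} \<Longrightarrow> j \<in> {1..<int p} \<Longrightarrow> [h i = h j] (mod int p)
                \<Longrightarrow> [i = j] (mod int p)"
  shows "[(\<Sum>j\<in>{1..<int p}. f (h j)) = (\<Sum>j\<in>{1..<int p}. f j)] (mod int p)"
proof -
  define g where "g = (\<lambda>j. h j mod int p)"
  have p0: "int p > 0" using prime_gt_0_nat[OF p] by simp
  have "g j \<in> {1..<int p}" if "j \<in> {1..<int p}" for j
  proof -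
    have "g j \<noteq> 0" using h[OF that] by (auto simp: g_def dvd_eq_mod_eq_0)
    moreover have "g j \<ge> 0" "g j < int p" using p0 by (simp_all add: g_def)
    ultimately show ?thesis by auto
  qed
  hence sub: "g ` {1..<int p} \<subseteq> {1..<int p}" by blast
  have inj_g: "inj_on g {1..<int p}"
  proof (rule inj_onI)
    fix i j assume ij: "i \<in> {1..<int p}" "j \<in> {1..<int p}" "g i = g j"
    hence "[i = j] (mod int p)" using inj by (simp add: g_def cong_def)
    thus "i = j" using ij by (simp add: cong_def)
  qed
  have "g ` {1..<int p} = {1..<int p}"
    using endo_inj_surj[OF _ sub inj_g] by simp
  hence bij: "bij_betw g {1..<int p} {1..<int p}" using inj_g by (simp add: bij_betw_def)
  have "[(\<Sum>j\<in>{1..<int p}. f (h j)) = (\<Sum>j\<in>{1..<int p}. f (g j))] (mod int p)"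
    by (intro cong_sum f) (simp add: g_def cong_def)
  also have "(\<Sum>j\<in>{1..<int p}. f (g j)) = (\<Sum>j\<in>{1..<int p}. f j)"
    by (rule sum.reindex_bij_betw[OF bij])
  finally show ?thesis .
qed

lemma sum_units_mult:
  fixes f :: "int \<Rightarrow> int"
  assumes p: "prime p" and a: "\<not> int p dvd a"
    and f: "\<And>x y. [x = y] (mod int p) \<Longrightarrow> [f x = f y] (mod int p)"
  shows "[(\<Sum>j\<in>{1..<int p}. f (a * j)) = (\<Sum>j\<in>{1..<int p}. f j)] (mod int p)"
proof (rule sum_units_reindex[OF p f])
  have "prime (int p)" using p by simp
  thus "\<not> int p dvd a * j" if "j \<in> {1..<int p}" for j
    using a not_dvd_units[OF that] by (simp add: prime_dvd_mult_iff)
  show "[i = j] (mod int p)" if "[a * i = a * j] (mod int p)" for i j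
    using cong_cancel_prime_int[OF p a that] .
qed

text \<open>A primitive root has order exactly \<open>p - 1\<close>. It serves to kill power sums
  and to show that the kernel vector \<open>j^k - j^l\<close> is not zero modulo
  \<open>p\<close>.\<close>

lemma ex_unit_power_neq_1:
  assumes p: "prime p" and m: "0 < m" "m < p - 1"
  shows "\<exists>g\<in>{1..<int p}. \<not> [g ^ m = 1] (mod int p)"
proof -
  obtain x where "residue_primroot p x" using prime_primitive_root_exists[OF prime_gt_1_nat[OF p] p] by blast
  hence cop: "coprime p x" and ord: "ord p x = p - 1"
    using totient_prime[OF p] by (auto simp: residue_primroot_def)
  define g where "g = x mod p"
  have p1: "p > 1" using prime_gt_1_nat[OF p] .
  have "\<not> p dvd x" using cop p1 by (metis coprime_absorb_left nat_dvd_1_iff_1 less_irrefl)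
  hence "g \<noteq> 0" by (simp add: g_def dvd_eq_mod_eq_0)
  moreover have "g < p" using p1 by (simp add: g_def)
  ultimately have gin: "int g \<in> {1..<int p}" by simp
  have "\<not> [x ^ m = 1] (mod p)"
    using ord_minimal[of m p x] m ord by simp
  hence "\<not> [g ^ m = 1] (mod p)" by (simp add: g_def cong_def power_mod)
  hence "\<not> [int g ^ m = 1] (mod int p)"
    by (metis cong_int_iff of_nat_1 of_nat_power)
  thus ?thesis using gin by blast
qed

text \<open>Replacing \<open>j\<close> by \<open>g * j\<close> permutes the units but scales the sum
  by \<open>g ^ m\<close>, which is not 1 modulo \<open>p\<close>.\<close>

lemma power_sum_cong_0:
  assumes p: "prime p" and m: "0 < m" "m < p - 1"
  shows "[(\<Sum>j\<in>{1..<int p}. j ^ m) = 0] (mod int p)"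
proof -
  obtain g where g: "g \<in> {1..<int p}" "\<not> [g ^ m = 1] (mod int p)"
    using ex_unit_power_neq_1[OF p m] by blast
  let ?S = "\<Sum>j\<in>{1..<int p}. j ^ m"
  have "[(\<Sum>j\<in>{1..<int p}. (g * j) ^ m) = ?S] (mod int p)"
    by (rule sum_units_mult[OF p not_dvd_units[OF g(1)]]) (rule cong_pow)
  also have "(\<Sum>j\<in>{1..<int p}. (g * j) ^ m) = g ^ m * ?S"
    by (simp add: power_mult_distrib sum_distrib_left)
  finally have "int p dvd (g ^ m - 1) * ?S"
    by (simp add: cong_iff_dvd_diff algebra_simps)
  moreover have "\<not> int p dvd g ^ m - 1" using g(2) by (simp add: cong_iff_dvd_diff)
  moreover have "prime (int p)" using p by simp
  ultimately have "int p dvd ?S" using prime_dvd_mult_iff by blast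
  thus ?thesis by (simp add: cong_iff_dvd_diff)
qed

section \<open>Moments of the inverse quadratic polynomial\<close>

text \<open>This is \<open>S m\<close> of the overview; the exponent \<open>p - 2\<close> stands for
  inversion modulo \<open>p\<close>.\<close>

definition quad_moment :: "nat \<Rightarrow> int \<Rightarrow> int \<Rightarrow> nat \<Rightarrow> int" where
  "quad_moment p c d m = (\<Sum>j\<in>{1..<int p}. j ^ m * (1 + c * j + d * j\<^sup>2) ^ (p - 2))"

text \<open>The combination multiplies each summand by the quadratic, which cancels its inverse and
  leaves the power sum of the \<open>j ^ m\<close>.\<close>

lemma quad_moment_rec:
  assumes p: "prime p"
    and irred: "\<And>j. j \<in> {1..<int p} \<Longrightarrow> \<not> int p dvd 1 + c * j + d * j\<^sup>2"
    and m: "0 < m" "m < p - 1"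
  shows "int p dvd d * quad_moment p c d (m + 2) + c * quad_moment p c d (m + 1)
           + quad_moment p c d m"
proof -
  let ?q = "\<lambda>j::int. 1 + c * j + d * j\<^sup>2"
  have "d * quad_moment p c d (m + 2) + c * quad_moment p c d (m + 1) + quad_moment p c d m
      = (\<Sum>j\<in>{1..<int p}. j ^ m * (?q j * ?q j ^ (p - 2)))"
    unfolding quad_moment_def sum_distrib_left sum.distrib[symmetric]
    by (intro sum.cong refl) (simp add: algebra_simps power2_eq_square)
  also have "[\<dots> = (\<Sum>j\<in>{1..<int p}. j ^ m * 1)] (mod int p)"
    by (intro cong_sum cong_mult cong_refl fermat_inverse_int[OF p irred])
  also have "(\<Sum>j\<in>{1..<int p}. j ^ m * 1) = (\<Sum>j\<in>{1..<int p}. j ^ m)" by simp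
  also have "[\<dots> = 0] (mod int p)" by (rule power_sum_cong_0[OF p m])
  finally show ?thesis by (simp add: cong_0_iff)
qed

text \<open>The substitution \<open>j \<mapsto> 1 / (d j)\<close>.\<close>

lemma quad_moment_reflect:
  assumes p: "prime p" and d: "\<not> int p dvd d" and m: "1 \<le> m" "m \<le> p"
  shows "int p dvd d ^ (m - 1) * quad_moment p c d m - quad_moment p c d (p + 1 - m)"
proof -
  let ?q = "\<lambda>j::int. 1 + c * j + d * j\<^sup>2"
  have pp: "prime (int p)" using p by simp
  define h where "h = (\<lambda>j. (d * j) ^ (p - 2))"
  have unit: "\<not> int p dvd d * j" if "j \<in> {1..<int p}" for j
    using d not_dvd_units[OF that] pp by (simp add: prime_dvd_mult_iff)
  have inv: "[d * j * h j = 1] (mod int p)" if "j \<in> {1..<int p}" for j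
    unfolding h_def by (rule fermat_inverse_int[OF p unit[OF that]])
  have hunit: "\<not> int p dvd h j" if "j \<in> {1..<int p}" for j
    using inv[OF that] p
    by (metis cong_dvd_iff dvd_mult not_prime_unit pp)
  have re: "[(\<Sum>j\<in>{1..<int p}. h j ^ (p + 1 - m) * ?q (h j) ^ (p - 2))
      = (\<Sum>j\<in>{1..<int p}. j ^ (p + 1 - m) * ?q j ^ (p - 2))] (mod int p)"
  proof (rule sum_units_reindex[OF p _ hunit])
    show "[x ^ (p + 1 - m) * ?q x ^ (p - 2) = y ^ (p + 1 - m) * ?q y ^ (p - 2)] (mod int p)"
      if "[x = y] (mod int p)" for x y
      by (intro cong_mult cong_pow cong_add cong_refl that)
    show "[i = j] (mod int p)"
      if ij: "i \<in> {1..<int p}" "j \<in> {1..<int p}" and eq: "[h i = h j] (mod int p)" for i j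
    proof -
      have "[(d * h j) * i = (d * h i) * i] (mod int p)"
        by (intro cong_mult cong_refl cong_sym[OF eq])
      also have "(d * h i) * i = d * i * h i" by (simp add: ac_simps)
      also have "[\<dots> = 1] (mod int p)" by (rule inv[OF ij(1)])
      also have "[1 = d * j * h j] (mod int p)" by (rule cong_sym[OF inv[OF ij(2)]])
      also have "d * j * h j = (d * h j) * j" by (simp add: ac_simps)
      finally have "[(d * h j) * i = (d * h j) * j] (mod int p)" .
      moreover have "\<not> int p dvd d * h j"
        using d hunit[OF ij(2)] pp by (simp add: prime_dvd_mult_iff)
      ultimately show ?thesis using cong_cancel_prime_int[OF p] by blast
    qed
  qed
  \<comment> \<open>With \<open>y = 1 / (d j)\<close> and \<open>u = d j^2\<close> one has
    \<open>u * q y = q j\<close> and \<open>1 / u = d y^2\<close>, so the left side is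
    \<open>(d j)^m y^2 / q y\<close>, that is, \<open>y^(2 - m) / q y\<close>.\<close>
  have point: "[d ^ (m - 1) * (j ^ m * ?q j ^ (p - 2)) = h j ^ (p + 1 - m) * ?q (h j) ^ (p - 2)] (mod int p)"
    if j: "j \<in> {1..<int p}" for j
  proof -
    define y where "y = h j"
    define u where "u = d * j\<^sup>2"
    have dy: "[d * j * y = 1] (mod int p)" using inv[OF j] by (simp add: y_def)
    have un: "\<not> int p dvd u"
      using d not_dvd_units[OF j] pp by (simp add: u_def prime_dvd_mult_iff prime_dvd_power_iff)
    have uinv: "[u * u ^ (p - 2) = 1] (mod int p)" by (rule fermat_inverse_int[OF p un])
    have "[u * (d * y\<^sup>2) = (d * j * y)\<^sup>2] (mod int p)"
      by (simp add: u_def power2_eq_square ac_simps)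
    also have "[(d * j * y)\<^sup>2 = 1\<^sup>2] (mod int p)" by (intro cong_pow dy)
    finally have "[u * (d * y\<^sup>2) = 1] (mod int p)" by simp
    hence "[u * u ^ (p - 2) = u * (d * y\<^sup>2)] (mod int p)"
      using uinv cong_sym cong_trans by blast
    hence upow: "[u ^ (p - 2) = d * y\<^sup>2] (mod int p)" using cong_cancel_prime_int[OF p un] by blast
    have "[u * ?q y = u + c * j * (d * j * y) + (d * j * y)\<^sup>2] (mod int p)"
      by (simp add: u_def power2_eq_square algebra_simps)
    also have "[u + c * j * (d * j * y) + (d * j * y)\<^sup>2 = u + c * j * 1 + 1\<^sup>2] (mod int p)"
      by (intro cong_add cong_mult cong_pow cong_refl dy)
    also have "u + c * j * 1 + 1\<^sup>2 = ?q j" by (simp add: u_def)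
    finally have "[?q j = u * ?q y] (mod int p)" by (rule cong_sym)
    hence "[?q j ^ (p - 2) = (u * ?q y) ^ (p - 2)] (mod int p)" by (rule cong_pow)
    also have "(u * ?q y) ^ (p - 2) = u ^ (p - 2) * ?q y ^ (p - 2)" by (rule power_mult_distrib)
    also have "[\<dots> = d * y\<^sup>2 * ?q y ^ (p - 2)] (mod int p)" by (intro cong_mult cong_refl upow)
    finally have q: "[?q j ^ (p - 2) = d * y\<^sup>2 * ?q y ^ (p - 2)] (mod int p)" .
    obtain k where k: "m = Suc k" using m by (cases m) auto
    have "[d ^ (m - 1) * (j ^ m * ?q j ^ (p - 2))
        = d ^ (m - 1) * (j ^ m * (d * y\<^sup>2 * ?q y ^ (p - 2)))] (mod int p)"
      by (intro cong_mult cong_refl q)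
    also have "d ^ (m - 1) * (j ^ m * (d * y\<^sup>2 * ?q y ^ (p - 2)))
        = (d * j) ^ k * (d * j * y) * y * ?q y ^ (p - 2)"
      by (simp add: k power2_eq_square power_mult_distrib ac_simps)
    also have "[\<dots> = (d * j) ^ k * 1 * y * ?q y ^ (p - 2)] (mod int p)"
      by (intro cong_mult cong_refl dy)
    \<comment> \<open>A factor \<open>y ^ (p - 1)\<close>, congruent to 1, is inserted so that
      cancelling \<open>(d * j) ^ k\<close> against powers of \<open>y\<close> leaves a natural
      exponent.\<close>
    also have "[(d * j) ^ k * 1 * y * ?q y ^ (p - 2)
        = (d * j) ^ k * y ^ (p - 1) * y * ?q y ^ (p - 2)] (mod int p)"
      by (intro cong_mult cong_refl cong_sym[OF fermat_theorem_int[OF p]]) (use hunit[OF j] in \<open>simp add: y_def\<close>)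
    also have "(d * j) ^ k * y ^ (p - 1) * y * ?q y ^ (p - 2)
        = (d * j * y) ^ k * y ^ (p + 1 - m) * ?q y ^ (p - 2)"
    proof -
      have e: "p - 1 = k + (p - m)" "p + 1 - m = Suc (p - m)" using m k by auto
      show ?thesis unfolding e by (simp add: power_add power_mult_distrib ac_simps)
    qed
    also have "[\<dots> = 1 ^ k * y ^ (p + 1 - m) * ?q y ^ (p - 2)] (mod int p)"
      by (intro cong_mult cong_pow cong_refl dy)
    finally show ?thesis by (simp add: y_def)
  qed
  have "d ^ (m - 1) * quad_moment p c d m
      = (\<Sum>j\<in>{1..<int p}. d ^ (m - 1) * (j ^ m * ?q j ^ (p - 2)))"
    by (simp add: quad_moment_def sum_distrib_left)
  also have "[\<dots> = (\<Sum>j\<in>{1..<int p}. h j ^ (p + 1 - m) * ?q (h j) ^ (p - 2))] (mod int p)"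
    by (intro cong_sum point)
  also note re
  also have "(\<Sum>j\<in>{1..<int p}. j ^ (p + 1 - m) * ?q j ^ (p - 2)) = quad_moment p c d (p + 1 - m)"
    by (simp add: quad_moment_def)
  finally show ?thesis by (simp add: cong_iff_dvd_diff)
qed

section \<open>Two vanishing moments make the determinant vanish\<close>

text \<open>Multiplying \<open>A w\<close> by the adjugate gives \<open>det A\<close> times
  \<open>w\<close>; at coordinate \<open>b\<close> the factor \<open>v b\<close> can be cancelled
  modulo \<open>q\<close>. This avoids passing to a matrix over the residue field.\<close>

lemma prime_dvd_det_of_kernel:
  fixes A :: "int mat" and v :: "nat \<Rightarrow> int"
  assumes q: "prime q" and A: "A \<in> carrier_mat n n"
    and ker: "\<And>i. i < n \<Longrightarrow> q dvd (\<Sum>j<n. A $$ (i, j) * v j)"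
    and b: "b < n" "\<not> q dvd v b"
  shows "q dvd det A"
proof -
  define w where "w = vec n v"
  have w: "w \<in> carrier_vec n" by (simp add: w_def)
  note adj = adj_mat[OF A]
  have Aw: "q dvd (A *\<^sub>v w) $ i" if "i < n" for i
  proof -
    have "(A *\<^sub>v w) $ i = (\<Sum>j<n. A $$ (i, j) * v j)"
      using A that by (auto simp: w_def scalar_prod_def lessThan_atLeast0 intro!: sum.cong)
    thus ?thesis using ker[OF that] by simp
  qed
  have "det A * v b = ((det A \<cdot>\<^sub>m 1\<^sub>m n) *\<^sub>v w) $ b"
    using b(1) w by (simp add: w_def)
  also have "\<dots> = (adj_mat A *\<^sub>v (A *\<^sub>v w)) $ b"
    using adj A w by (metis assoc_mult_mat_vec)
  also have "\<dots> = (\<Sum>j<n. adj_mat A $$ (b, j) * (A *\<^sub>v w) $ j)"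
    using adj(1) A b(1) by (auto simp: scalar_prod_def lessThan_atLeast0 intro!: sum.cong)
  also have "q dvd \<dots>" using Aw by (intro dvd_sum) auto
  finally show ?thesis using q b(2) by (simp add: prime_dvd_mult_iff)
qed

text \<open>Substituting \<open>i * j\<close> for \<open>j\<close> pulls \<open>i^2\<close> out of
  the quadratic form and \<open>i ^ m\<close> out of the character.\<close>

lemma row_moment:
  assumes p: "prime p" and i: "\<not> int p dvd i"
  shows "[(\<Sum>j\<in>{1..<int p}. (i\<^sup>2 + c * i * j + d * j\<^sup>2) ^ (p - 2) * j ^ m)
    = (i\<^sup>2) ^ (p - 2) * i ^ m * quad_moment p c d m] (mod int p)" (is "[?L = ?R] (mod _)")
proof -
  have "[(\<Sum>j\<in>{1..<int p}. (i\<^sup>2 + c * i * (i * j) + d * (i * j)\<^sup>2) ^ (p - 2) * (i * j) ^ m) = ?L] (mod int p)"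
    by (rule sum_units_mult[OF p i, where f = "\<lambda>j. (i\<^sup>2 + c * i * j + d * j\<^sup>2) ^ (p - 2) * j ^ m"])
       (intro cong_mult cong_pow cong_add cong_refl)
  moreover have "(i\<^sup>2 + c * i * (i * j) + d * (i * j)\<^sup>2) ^ (p - 2) * (i * j) ^ m
      = (i\<^sup>2) ^ (p - 2) * i ^ m * (j ^ m * (1 + c * j + d * j\<^sup>2) ^ (p - 2))" for j
  proof -
    have e: "i\<^sup>2 + c * i * (i * j) + d * (i * j)\<^sup>2 = i\<^sup>2 * (1 + c * j + d * j\<^sup>2)"
      by (simp add: power2_eq_square algebra_simps)
    show ?thesis unfolding e by (simp only: power_mult_distrib ac_simps)
  qed
  ultimately have "[?R = ?L] (mod int p)" by (simp add: quad_moment_def sum_distrib_left)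
  thus ?thesis by (rule cong_sym)
qed

text \<open>The even distance makes \<open>j^k - j^l\<close> vanish at 1 and -1, so dropping these
  columns leaves the row sums unchanged modulo \<open>p\<close>; a distance below
  \<open>p - 1\<close> keeps the vector nonzero.\<close>

lemma dvd_Dp_minus_of_two_zeros:
  assumes p: "prime p" "p > 3"
    and zero: "int p dvd quad_moment p c d k" "int p dvd quad_moment p c d l"
    and kl: "k < l" "l - k < p - 1" "even (l - k)"
  shows "int p dvd Dp_minus p c d"
proof -
  define v where "v = (\<lambda>j::int. j ^ k - j ^ l)"
  define e where "e = (\<lambda>b. int (b + 2))"
  have e_image: "e ` {..<p - 3} = {2..<int p - 1}"
  proof (intro equalityI subsetI)
    fix x assume "x \<in> {2..<int p - 1}"
    hence "x = e (nat x - 2)" "nat x - 2 < p - 3" by (auto simp: e_def)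
    thus "x \<in> e ` {..<p - 3}" by blast
  qed (use p in \<open>auto simp: e_def\<close>)
  have bij: "bij_betw e {..<p - 3} {2..<int p - 1}"
    using e_image by (auto simp: bij_betw_def inj_on_def e_def)
  have v_1: "v 1 = 0" by (simp add: v_def)
  have par: "even k \<longleftrightarrow> even l" using kl by auto
  \<comment> \<open>\<open>int p - 1\<close> is the representative of -1 among the indices.\<close>
  have "[v (int p - 1) = v (-1)] (mod int p)"
    unfolding v_def by (intro cong_diff cong_pow) (simp_all add: cong_iff_dvd_diff)
  moreover have "v (-1) = 0" using par by (simp add: v_def minus_one_power_iff)
  ultimately have v_m1: "int p dvd v (int p - 1)" by (simp add: cong_0_iff)
  obtain g where g: "g \<in> {1..<int p}" "\<not> [g ^ (l - k) = 1] (mod int p)"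
    using ex_unit_power_neq_1[OF p(1), of "l - k"] kl by auto
  have pp: "prime (int p)" using p by simp
  have vg: "\<not> int p dvd v g"
  proof
    assume "int p dvd v g"
    moreover have "v g = - (g ^ k * (g ^ (l - k) - 1))"
    proof -
      have "g ^ l = g ^ k * g ^ (l - k)" using kl by (simp flip: power_add)
      thus ?thesis by (simp add: v_def algebra_simps)
    qed
    ultimately have "int p dvd g ^ k * (g ^ (l - k) - 1)" by simp
    moreover have "\<not> int p dvd g ^ (l - k) - 1" using g(2) by (simp add: cong_iff_dvd_diff)
    ultimately have "int p dvd g ^ k" using pp prime_dvd_mult_iff by blast
    thus False using pp prime_dvd_power not_dvd_units[OF g(1)] by blast
  qed
  \<comment> \<open>Since \<open>v\<close> vanishes modulo \<open>p\<close> at both removed indices,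
    \<open>g\<close> is a retained one.\<close>
  hence "g \<noteq> 1" "g \<noteq> int p - 1" using v_1 v_m1 by auto
  hence "g \<in> e ` {..<p - 3}" unfolding e_image using g(1) by auto
  then obtain b where b: "b < p - 3" "g = e b" by auto
  have ker: "int p dvd (\<Sum>j<p - 3. Dp_minus_mat p c d $$ (i, j) * v (e j))" if i: "i < p - 3" for i
  proof -
    let ?F = "\<lambda>j. ((e i)\<^sup>2 + c * e i * j + d * j\<^sup>2) ^ (p - 2)"
    have "e i \<in> {1..<int p}" using i by (auto simp: e_def)
    note ei = not_dvd_units[OF this]
    have moment: "int p dvd (\<Sum>j\<in>{1..<int p}. ?F j * j ^ m)"
      if "int p dvd quad_moment p c d m" for m
      using cong_dvd_iff[OF row_moment[OF p(1) ei]] that by simp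
    have "int p dvd (\<Sum>j\<in>{1..<int p}. ?F j * v j)"
      using dvd_diff[OF moment[OF zero(1)] moment[OF zero(2)]]
      by (simp add: v_def right_diff_distrib sum_subtractf)
    also have "{1..<int p} = insert 1 (insert (int p - 1) {2..<int p - 1})" using p by auto
    also have "(\<Sum>j\<in>\<dots>. ?F j * v j)
        = ?F (int p - 1) * v (int p - 1) + (\<Sum>j\<in>{2..<int p - 1}. ?F j * v j)"
      using p v_1 by simp
    finally have "int p dvd (\<Sum>j\<in>{2..<int p - 1}. ?F j * v j)"
      using v_m1 by (simp add: dvd_add_right_iff)
    also have "\<dots> = (\<Sum>j<p - 3. ?F (e j) * v (e j))"
      by (rule sum.reindex_bij_betw[OF bij, symmetric])
    also have "\<dots> = (\<Sum>j<p - 3. Dp_minus_mat p c d $$ (i, j) * v (e j))"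
      using i by (intro sum.cong refl) (simp add: Dp_minus_mat_def e_def Let_def)
    finally show ?thesis .
  qed
  show ?thesis unfolding Dp_minus_def
    by (rule prime_dvd_det_of_kernel[where v = "\<lambda>j. v (e j)", OF pp _ ker b(1)])
       (use vg b(2) in \<open>simp_all add: Dp_minus_mat_def\<close>)
qed

section \<open>Symmetry of the moments about the central index\<close>

text \<open>Here \<open>h - 1 = (p - 1) / 2\<close>, so by Fermat the power is a square root of 1:
  the Legendre symbol of \<open>d\<close>.\<close>

lemma power_half_dichotomy:
  assumes p: "prime p" "p = 2 * h - 1" and h: "h \<ge> 1" and d: "\<not> int p dvd d"
  shows "int p dvd d ^ (h - 1) - 1 \<or> int p dvd d ^ (h - 1) + 1"
proof -
  have "p - 1 = (h - 1) + (h - 1)" using p h by simp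
  with fermat_theorem_int[OF p(1) d]
  have "int p dvd d ^ (h - 1) * d ^ (h - 1) - 1" by (simp add: cong_iff_dvd_diff power_add)
  hence "int p dvd (d ^ (h - 1) - 1) * (d ^ (h - 1) + 1)" by (simp add: algebra_simps)
  thus ?thesis using p(1) by (simp add: prime_dvd_mult_iff)
qed

text \<open>As \<open>p + 1 = 2 * h\<close>, the reflection of exponents \<open>m\<close> to
  \<open>p + 1 - m\<close> is centred at \<open>h\<close>. In use, \<open>e\<close> is the sign of
  \<open>d ^ (h - 1)\<close>.\<close>

lemma quad_moment_reflect_center:
  assumes p: "prime p" "p = 2 * h - 1" and d: "\<not> int p dvd d" and k: "k < h"
    and e: "int p dvd d ^ (h - 1) - e"
  shows "int p dvd e * d ^ k * quad_moment p c d (h + k) - quad_moment p c d (h - k)"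
proof -
  have "int p dvd d ^ (h + k - 1) * quad_moment p c d (h + k) - quad_moment p c d (p + 1 - (h + k))"
    using p k by (intro quad_moment_reflect[OF p(1) d]) auto
  moreover have e1: "p + 1 - (h + k) = h - k" and e2: "h + k - 1 = (h - 1) + k"
    using p(2) k by simp_all
  ultimately have *: "int p dvd d ^ (h - 1) * d ^ k * quad_moment p c d (h + k)
      - quad_moment p c d (h - k)"
    by (simp only: e1 e2 power_add)
  have "int p dvd (d ^ (h - 1) - e) * (d ^ k * quad_moment p c d (h + k))"
    using e by (rule dvd_mult2)
  from dvd_diff[OF * this] show ?thesis by (simp add: algebra_simps)
qed

section \<open>The three quadratic polynomials have no roots\<close>

text \<open>Otherwise raising \<open>x^2 = -y^2\<close> to the odd exponent
  \<open>(p - 1) / 2\<close> gives \<open>1 = -1\<close> modulo \<open>p\<close> by Fermat.\<close>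

lemma prime_3_mod_4_dvd_sum_squares:
  fixes x y :: int
  assumes p: "prime p" "p mod 4 = 3" and xy: "int p dvd x\<^sup>2 + y\<^sup>2"
  shows "int p dvd y"
proof (rule ccontr)
  assume y: "\<not> int p dvd y"
  have pp: "prime (int p)" using p by simp
  have "\<not> int p dvd x"
  proof
    assume "int p dvd x"
    hence "int p dvd x\<^sup>2" by (simp add: power2_eq_square)
    with xy have "int p dvd y\<^sup>2" by (simp add: dvd_add_right_iff)
    thus False using y pp prime_dvd_power by blast
  qed
  note x = this
  obtain k where k: "p - 1 = 2 * (2 * k + 1)"
  proof
    show "p - 1 = 2 * (2 * (p div 4) + 1)"
      using p(2) by presburger
  qed
  have "[x\<^sup>2 = - (y\<^sup>2)] (mod int p)" using xy by (simp add: cong_iff_dvd_diff)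
  hence "[(x\<^sup>2) ^ (2 * k + 1) = (- (y\<^sup>2)) ^ (2 * k + 1)] (mod int p)" by (rule cong_pow)
  also have "(x\<^sup>2) ^ (2 * k + 1) = x ^ (p - 1)" by (simp only: k power_mult)
  also have "(- (y\<^sup>2)) ^ (2 * k + 1) = - ((y\<^sup>2) ^ (2 * k + 1))" by (rule power_minus_odd) simp
  also have "(y\<^sup>2) ^ (2 * k + 1) = y ^ (p - 1)" by (simp only: k power_mult)
  finally have "[x ^ (p - 1) = - (y ^ (p - 1))] (mod int p)" .
  moreover have "[x ^ (p - 1) = 1] (mod int p)" by (rule fermat_theorem_int[OF p(1) x])
  moreover have "[- (y ^ (p - 1)) = - 1] (mod int p)"
    using fermat_theorem_int[OF p(1) y] by (simp add: cong_minus_minus_iff)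
  ultimately have "[1 = - 1] (mod int p)" by (meson cong_sym cong_trans)
  hence "int p dvd 2" by (simp add: cong_iff_dvd_diff)
  hence "p \<le> 2" using zdvd_imp_le by fastforce
  moreover have "p \<ge> 3" using p(2) by (metis mod_less_eq_dividend)
  ultimately show False by simp
qed

text \<open>Since 3 divides \<open>p - 2\<close>, the inverse \<open>x ^ (p - 2)\<close> of a unit
  is a power of its cube.\<close>

lemma cube_cong_cancel:
  fixes x y :: int
  assumes p: "prime p" "p mod 3 = 2" and xy: "[x ^ 3 = y ^ 3] (mod int p)"
  shows "[x = y] (mod int p)"
proof (cases "int p dvd x \<or> int p dvd y")
  case True
  have pp: "prime (int p)" using p by simp
  have "int p dvd x ^ 3 \<longleftrightarrow> int p dvd y ^ 3" by (rule cong_dvd_iff[OF xy])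
  hence "int p dvd x \<and> int p dvd y" using True pp by (simp add: prime_dvd_power_iff)
  thus ?thesis by (simp add: cong_iff_dvd_diff)
next
  case False
  have "p - 2 = 3 * (p div 3)" using p(2) div_mult_mod_eq[of p 3] by linarith
  hence "[x ^ (p - 2) = y ^ (p - 2)] (mod int p)"
    using cong_pow[OF xy, of "p div 3"] by (simp add: power_mult)
  hence eq: "[x * y * x ^ (p - 2) = x * y * y ^ (p - 2)] (mod int p)" by (intro cong_mult cong_refl)
  have "[y * 1 = y * (x * x ^ (p - 2))] (mod int p)"
    using False by (intro cong_mult cong_refl cong_sym[OF fermat_inverse_int[OF p(1)]]) simp
  also have "y * (x * x ^ (p - 2)) = x * y * x ^ (p - 2)" by (simp only: ac_simps)
  also note eq
  also have "x * y * y ^ (p - 2) = x * (y * y ^ (p - 2))" by (simp only: ac_simps)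
  also have "[\<dots> = x * 1] (mod int p)"
    using False by (intro cong_mult cong_refl fermat_inverse_int[OF p(1)]) simp
  finally show ?thesis by (simp add: cong_sym)
qed

text \<open>The quadratic is \<open>j^2 + (j + 1)^2\<close>, and \<open>p\<close> cannot divide two
  consecutive integers.\<close>

lemma no_root_2_2:
  assumes p: "prime p" "p mod 4 = 3"
  shows "\<not> int p dvd 1 + 2 * j + 2 * j\<^sup>2"
proof
  assume "int p dvd 1 + 2 * j + 2 * j\<^sup>2"
  moreover have "1 + 2 * j + 2 * j\<^sup>2 = (j + 1)\<^sup>2 + j\<^sup>2" "(j + 1)\<^sup>2 + j\<^sup>2 = j\<^sup>2 + (j + 1)\<^sup>2"
    by (simp_all add: power2_eq_square algebra_simps)
  ultimately have "int p dvd j" "int p dvd j + 1"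
    using prime_3_mod_4_dvd_sum_squares[OF p] by metis+
  hence "int p dvd 1" using dvd_add_right_iff by blast
  thus False using prime_gt_1_nat[OF p(1)] by simp
qed

text \<open>The quadratic is a difference of consecutive cubes, and cubing is injective modulo
  \<open>p\<close>.\<close>

lemma no_root_3_3:
  assumes p: "prime p" "p mod 3 = 2"
  shows "\<not> int p dvd 1 + 3 * j + 3 * j\<^sup>2"
proof
  assume "int p dvd 1 + 3 * j + 3 * j\<^sup>2"
  moreover have "1 + 3 * j + 3 * j\<^sup>2 = (j + 1) ^ 3 - j ^ 3"
    by (simp add: power2_eq_square power3_eq_cube algebra_simps)
  ultimately have "[(j + 1) ^ 3 = j ^ 3] (mod int p)" by (simp add: cong_iff_dvd_diff)
  hence "[j + 1 = j] (mod int p)" by (rule cube_cong_cancel[OF p])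
  thus False using prime_gt_1_nat[OF p(1)] by (simp add: cong_iff_dvd_diff)
qed

text \<open>The reciprocity sign is 1 because \<open>(5 - 1) / 2\<close> is even, and 2 and 3 are
  non-residues modulo 5.\<close>

lemma Legendre_5:
  assumes p: "prime p" "p > 2" "p mod 5 = 2 \<or> p mod 5 = 3"
  shows "Legendre 5 (int p) = -1"
proof -
  have five: "prime (5::nat)" by simp
  have "p \<noteq> 5" using p by auto
  hence "Legendre (int p) (int 5) * Legendre (int 5) (int p) = (-1) ^ ((p - 1) div 2 * ((5 - 1) div 2))"
    using p five by (intro Quadratic_Reciprocity) auto
  hence rec: "Legendre (int p) 5 * Legendre 5 (int p) = 1" by (simp add: power_mult_distrib mult.commute[of _ 2] power_mult)
  have "int p mod 5 = 2 \<or> int p mod 5 = 3" using p(3) by presburger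
  hence pm: "(int p)\<^sup>2 mod 5 = 4"
    by (auto simp: power2_eq_square mod_mult_eq[of "int p" 5 "int p", symmetric])
  have "[Legendre (int p) (int 5) = (int p) ^ ((5 - 1) div 2)] (mod int 5)"
    by (rule euler_criterion) (use five in auto)
  hence "Legendre (int p) 5 mod 5 = 4" using pm by (simp add: cong_def)
  hence "Legendre (int p) 5 = -1" by (auto simp: Legendre_def split: if_splits)
  thus ?thesis using rec by simp
qed

text \<open>The discriminant is 5, a non-residue modulo \<open>p\<close>.\<close>

lemma no_root_3_1:
  assumes p: "prime p" "p > 2" "p mod 5 = 2 \<or> p mod 5 = 3"
  shows "\<not> int p dvd 1 + 3 * j + 1 * j\<^sup>2"
proof
  assume "int p dvd 1 + 3 * j + 1 * j\<^sup>2"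
  hence "int p dvd 4 * (1 + 3 * j + 1 * j\<^sup>2)" by (rule dvd_mult)
  also have "4 * (1 + 3 * j + 1 * j\<^sup>2) = (2 * j + 3)\<^sup>2 - 5"
    by (simp add: power2_eq_square algebra_simps)
  finally have "QuadRes (int p) 5" by (auto simp: QuadRes_def cong_iff_dvd_diff)
  thus False using Legendre_5[OF p] by (auto simp: Legendre_def split: if_splits)
qed

section \<open>Fibonacci numbers modulo a prime\<close>

text \<open>Binet's formula expanded by the binomial theorem: the even powers of
  \<open>sqrt 5\<close> cancel.\<close>

lemma fib_binomial_sum:
  "2 ^ n * int (fib n) = 2 * (\<Sum>k\<le>n. if odd k then int (n choose k) * 5 ^ (k div 2) else 0)"
proof -
  let ?r = "sqrt 5"
  have pow: "?r ^ k - (- ?r) ^ k = 2 * ?r * (if odd k then 5 ^ (k div 2) else 0)" for k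
  proof (cases "odd k")
    case True
    then obtain l where "k = 2 * l + 1" by (elim oddE)
    thus ?thesis by (simp add: power_mult)
  qed auto
  have "real (fib n) = (((1 + ?r) / 2) ^ n - ((1 - ?r) / 2) ^ n) / ?r" by (rule fib_closed_form)
  hence "?r * (2 ^ n * real (fib n)) = (?r + 1) ^ n - (- ?r + 1) ^ n"
    by (simp add: power_divide field_simps)
  also have "\<dots> = (\<Sum>k\<le>n. real (n choose k) * (?r ^ k - (- ?r) ^ k))"
    unfolding binomial_ring by (simp add: sum_subtractf algebra_simps)
  also have "\<dots> = ?r * (2 * (\<Sum>k\<le>n. if odd k then real (n choose k) * 5 ^ (k div 2) else 0))"
    unfolding pow sum_distrib_left by (intro sum.cong refl) simp
  finally have "2 ^ n * real (fib n)
      = 2 * (\<Sum>k\<le>n. if odd k then real (n choose k) * 5 ^ (k div 2) else 0)" by simp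
  also have "\<dots> = of_int (2 * (\<Sum>k\<le>n. if odd k then int (n choose k) * 5 ^ (k div 2) else 0))"
    by (simp add: of_int_sum if_distrib cong: if_cong)
  finally have "of_int (2 ^ n * int (fib n))
      = (of_int (2 * (\<Sum>k\<le>n. if odd k then int (n choose k) * 5 ^ (k div 2) else 0)) :: real)"
    by simp
  thus ?thesis by (simp only: of_int_eq_iff)
qed

text \<open>Modulo \<open>p\<close> only the term \<open>k = p\<close> of the binomial sum survives,
  and Euler's criterion evaluates its power of 5.\<close>

lemma fib_prime_cong_Legendre:
  assumes p: "prime p" "p > 2"
  shows "[int (fib p) = Legendre 5 (int p)] (mod int p)"
proof -
  have odd: "odd p" using p prime_odd_nat by blast
  have n2: "\<not> int p dvd 2" using p(2) zdvd_imp_le by fastforce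
  have "(\<Sum>k\<le>p. if odd k then int (p choose k) * 5 ^ (k div 2) else 0)
      = (\<Sum>k<p. if odd k then int (p choose k) * 5 ^ (k div 2) else 0) + 5 ^ (p div 2)"
    using odd by (simp flip: lessThan_Suc_atMost)
  also have "[\<dots> = 0 + 5 ^ (p div 2)] (mod int p)"
  proof (intro cong_add cong_refl)
    have "int p dvd (if odd k then int (p choose k) * 5 ^ (k div 2) else 0)" if "k < p" for k
    proof (cases "odd k")
      case True
      \<comment> \<open>Oddness of \<open>k\<close> excludes \<open>k = 0\<close>, where the
        binomial coefficient is 1.\<close>
      hence "p dvd p choose k" using that p by (intro dvd_choose_prime) (auto elim: oddE)
      thus ?thesis by simp
    qed simp
    thus "[(\<Sum>k<p. if odd k then int (p choose k) * 5 ^ (k div 2) else 0) = 0] (mod int p)"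
      unfolding cong_0_iff by (intro dvd_sum) auto
  qed
  finally have "[2 * (\<Sum>k\<le>p. if odd k then int (p choose k) * 5 ^ (k div 2) else 0)
      = 2 * 5 ^ (p div 2)] (mod int p)" by (intro cong_mult cong_refl) simp
  hence "[2 ^ p * int (fib p) = 2 * 5 ^ (p div 2)] (mod int p)" unfolding fib_binomial_sum .
  moreover have "2 ^ p = 2 * (2::int) ^ (p - 1)" using p by (simp flip: power_Suc)
  moreover have "[2 * 2 ^ (p - 1) * int (fib p) = 2 * 1 * int (fib p)] (mod int p)"
    by (intro cong_mult cong_refl fermat_theorem_int p n2)
  ultimately have "[2 * int (fib p) = 2 * 5 ^ (p div 2)] (mod int p)"
    by (metis cong_sym cong_trans mult.right_neutral)
  hence "[int (fib p) = 5 ^ (p div 2)] (mod int p)" by (rule cong_cancel_prime_int[OF p(1) n2])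
  moreover have "p div 2 = (p - 1) div 2" using odd by (auto elim: oddE)
  ultimately show ?thesis using euler_criterion[OF p, of 5] by (metis cong_sym cong_trans)
qed

text \<open>With \<open>F\<close> the Fibonacci numbers, \<open>F p = (F (h - 1))\<^sup>2 + (F h)\<^sup>2 \<equiv> -1\<close> and Cassini's identity
  add up to \<open>F (h - 1) * L h \<equiv> 0\<close>, where \<open>L h = 2 * F (h - 1) + F h\<close> is a Lucas number.\<close>

lemma prime_dvd_Lucas:
  assumes p: "prime p" "p = 2 * h - 1" "even h" "h \<ge> 2" "p mod 5 = 2 \<or> p mod 5 = 3"
  shows "int p dvd 2 * int (fib (Suc h)) - int (fib h)"
proof -
  obtain n where n: "h = Suc n" using p by (cases h) auto
  have p2: "p > 2" using p by auto
  have pp: "prime (int p)" using p(1) by simp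
  define a b where "a = int (fib n)" and "b = int (fib h)"
  have S: "int (fib (Suc h)) = a + b" by (simp add: a_def b_def n)
  have "p = Suc (2 * n)" using p n by simp
  hence "int (fib p) = a\<^sup>2 + b\<^sup>2" using fib_rec_odd[of n] by (simp add: a_def b_def n)
  with fib_prime_cong_Legendre[OF p(1) p2] have F: "int p dvd a\<^sup>2 + b\<^sup>2 + 1"
    using Legendre_5[OF p(1) p2 p(5)] by (simp add: cong_iff_dvd_diff)
  \<comment> \<open>The sign in Cassini's identity is fixed by \<open>h\<close> being even.\<close>
  have "(a + b) * a - b\<^sup>2 = 1"
    using fib_Cassini_int[of n] S p(3) by (simp add: n a_def b_def algebra_simps)
  hence "a * (2 * a + b) = a\<^sup>2 + b\<^sup>2 + 1" by (simp add: algebra_simps power2_eq_square)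
  with F have "int p dvd a \<or> int p dvd 2 * a + b" using pp by (metis prime_dvd_mult_iff)
  \<comment> \<open>If \<open>p\<close> divided \<open>a\<close>, it would divide
    \<open>b^2 + 1\<close>, impossible for a prime that is 3 modulo 4.\<close>
  moreover have "\<not> int p dvd a"
  proof
    assume "int p dvd a"
    hence "int p dvd a\<^sup>2" by (simp add: power2_eq_square)
    with F have "int p dvd (a\<^sup>2 + b\<^sup>2 + 1) - a\<^sup>2" by (rule dvd_diff)
    hence "int p dvd b\<^sup>2 + 1\<^sup>2" by simp
    moreover have "p mod 4 = 3"
    proof -
      obtain t where t: "h = 2 * t" using p(3) by (elim evenE)
      then obtain u where "t = Suc u" using p(4) by (cases t) auto
      hence "p = 4 * u + 3" using p(2) t by simp
      thus ?thesis by simp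
    qed
    ultimately have "int p dvd 1" using prime_3_mod_4_dvd_sum_squares[OF p(1), of b 1] by blast
    thus False using p2 by simp
  qed
  moreover have "2 * int (fib (Suc h)) - int (fib h) = 2 * a + b" by (simp add: S b_def)
  ultimately show ?thesis by simp
qed

section \<open>The three cases\<close>

lemma dvd_Dp_minus_2_2:
  assumes p: "prime p" "p > 3" "p mod 8 = 7"
  shows "int p dvd Dp_minus p 2 2"
proof -
  define s where "s = quad_moment p 2 2"
  define h where "h = (p + 1) div 2"
  have h: "p = 2 * h - 1" "h \<ge> 4" "even h" using p unfolding h_def by presburger+
  have pp: "prime (int p)" using p by simp
  have n2: "\<not> int p dvd 2" using p(2) zdvd_imp_le by fastforce
  have n4: "\<not> int p dvd 4 * x" if "\<not> int p dvd x" for x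
  proof -
    have "(4::int) = 2 * 2" by simp
    thus ?thesis using that n2 pp by (metis prime_dvd_mult_iff)
  qed
  have "p mod 4 = 3" using p(3) by presburger
  hence rec: "int p dvd 2 * s (m + 2) + 2 * s (m + 1) + s m" if "0 < m" "m < p - 1" for m
    unfolding s_def using that by (intro quad_moment_rec[OF p(1) no_root_2_2[OF p(1)]])
  show ?thesis
  proof (cases "int p dvd 2 ^ (h - 1) - 1")
    case True
    have refl: "int p dvd 2 ^ k * s (h + k) - s (h - k)" if "k < h" for k
      using quad_moment_reflect_center[OF p(1) h(1) n2 that True] by (simp add: s_def)
    have hm: "h - 1 + 2 = h + 1" "h - 1 + 1 = h" using h by auto
    have C0: "int p dvd 2 * s (h + 1) + 2 * s h + s (h - 1)"
      using rec[of "h - 1"] h unfolding hm by simp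
    have R1: "int p dvd 2 * s (h + 1) - s (h - 1)" using refl[of 1] h by simp
    have C1: "int p dvd 2 * s (h + 2) + 2 * s (h + 1) + s h" using rec[of h] h by simp
    \<comment> \<open>Adding \<open>C0\<close> and \<open>R1\<close> eliminates
      \<open>s (h - 1)\<close> and gives \<open>s h = -2 * s (h + 1)\<close> modulo
      \<open>p\<close>; then \<open>C1\<close> forces \<open>s (h + 2) = 0\<close>.\<close>
    have "int p dvd 2 * (2 * s (h + 2) + 2 * s (h + 1) + s h)
        - ((2 * s (h + 1) + 2 * s h + s (h - 1)) + (2 * s (h + 1) - s (h - 1)))"
      by (rule dvd_diff[OF dvd_mult[OF C1] dvd_add[OF C0 R1]])
    hence "int p dvd 4 * s (h + 2)" by (simp add: algebra_simps)
    hence z1: "int p dvd s (h + 2)" using n4 by blast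
    have "int p dvd 4 * s (h + 2) - s (h - 2)" using refl[of 2] h by simp
    hence z2: "int p dvd s (h - 2)" using z1 by (metis dvd_diff_right_iff dvd_mult)
    show ?thesis
      by (rule dvd_Dp_minus_of_two_zeros[OF p(1,2) z2[unfolded s_def] z1[unfolded s_def]])
         (use h in auto)
  next
    case False
    hence e: "int p dvd 2 ^ (h - 1) - (-1)"
      using power_half_dichotomy[OF p(1) h(1) _ n2] h by auto
    \<comment> \<open>The recurrence is applied up to index \<open>h + 2\<close>, which must lie
      below \<open>p - 1 = 2 * h - 2\<close>; this fails at \<open>h = 4\<close>.\<close>
    have "p \<noteq> 7"
    proof
      assume "p = 7"
      hence "h = 4" using h by simp
      thus False using e \<open>p = 7\<close> by simp
    qed
    hence h8: "h \<ge> 8" using p(2,3) unfolding h_def by presburger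
    \<comment> \<open>With sign -1, reflection at the centre itself reads
      \<open>s h = - s h\<close>.\<close>
    have "int p dvd (-1) * 2 ^ 0 * s (h + 0) - s (h - 0)"
      unfolding s_def by (rule quad_moment_reflect_center[OF p(1) h(1) n2 _ e]) (use h in auto)
    hence "int p dvd 2 * s h" by (simp add: dvd_diff_commute)
    hence z1: "int p dvd s h" using pp n2 by (simp add: prime_dvd_mult_iff)
    have C: "int p dvd 2 * s (h + 2) + 2 * s (h + 1) + s h"
      "int p dvd 2 * s (h + 3) + 2 * s (h + 2) + s (h + 1)"
      "int p dvd 2 * s (h + 4) + 2 * s (h + 3) + s (h + 2)"
      using rec[of h] rec[of "h + 1"] rec[of "h + 2"] h h8 by (simp_all add: eval_nat_numeral)
    \<comment> \<open>\<open>4 X^4 + 1 = (2 X\<^sup>2 + 2 X + 1) (2 X\<^sup>2 - 2 X + 1)\<close>\<close>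
    have "int p dvd 2 * (2 * s (h + 4) + 2 * s (h + 3) + s (h + 2))
        - 2 * (2 * s (h + 3) + 2 * s (h + 2) + s (h + 1))
        + (2 * s (h + 2) + 2 * s (h + 1) + s h) - s h"
      by (rule dvd_diff[OF dvd_add[OF dvd_diff[OF dvd_mult[OF C(3)] dvd_mult[OF C(2)]] C(1)] z1])
    hence "int p dvd 4 * s (h + 4)" by (simp add: algebra_simps)
    hence z2: "int p dvd s (h + 4)" using n4 by blast
    show ?thesis
      by (rule dvd_Dp_minus_of_two_zeros[OF p(1,2) z1[unfolded s_def] z2[unfolded s_def]])
         (use h h8 in auto)
  qed
qed

lemma dvd_Dp_minus_3_3:
  assumes p: "prime p" "p > 5" "p mod 3 = 2"
  shows "int p dvd Dp_minus p 3 3"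
proof -
  define s where "s = quad_moment p 3 3"
  define h where "h = (p + 1) div 2"
  have "odd p" using p prime_odd_nat[of p] by simp
  hence h: "p = 2 * h - 1" "h \<ge> 6" using p unfolding h_def by presburger+
  have pp: "prime (int p)" using p by simp
  have n2: "\<not> int p dvd 2" using p(2) zdvd_imp_le by fastforce
  have n3: "\<not> int p dvd 3" using p(2) zdvd_imp_le by fastforce
  have n9: "\<not> int p dvd 9 * x" if "\<not> int p dvd x" for x
  proof -
    have "(9::int) = 3 * 3" by simp
    thus ?thesis using that n3 pp by (metis prime_dvd_mult_iff)
  qed
  have rec: "int p dvd 3 * s (m + 2) + 3 * s (m + 1) + s m" if "0 < m" "m < p - 1" for m
    unfolding s_def using that p by (intro quad_moment_rec[OF p(1) no_root_3_3[OF p(1)]])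
  have p3: "p > 3" using p by simp
  show ?thesis
  proof (cases "int p dvd 3 ^ (h - 1) - 1")
    case True
    have refl: "int p dvd 3 ^ k * s (h + k) - s (h - k)" if "k < h" for k
      using quad_moment_reflect_center[OF p(1) h(1) n3 that True] by (simp add: s_def)
    have hm: "h - 1 + 2 = h + 1" "h - 1 + 1 = h" using h by auto
    have C0: "int p dvd 3 * s (h + 1) + 3 * s h + s (h - 1)"
      using rec[of "h - 1"] h unfolding hm by simp
    have R1: "int p dvd 3 * s (h + 1) - s (h - 1)" using refl[of 1] h by simp
    have C1: "int p dvd 3 * s (h + 2) + 3 * s (h + 1) + s h" using rec[of h] h by simp
    have C2: "int p dvd 3 * s (h + 3) + 3 * s (h + 2) + s (h + 1)"
      using rec[of "h + 1"] h by (simp add: eval_nat_numeral)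
    \<comment> \<open>Again \<open>s h = -2 * s (h + 1)\<close> modulo \<open>p\<close>; so
      \<open>C1\<close> gives \<open>3 * s (h + 2) = - s (h + 1)\<close>, and \<open>C2\<close>
      gives \<open>s (h + 3) = 0\<close>.\<close>
    have "int p dvd 3 * (3 * s (h + 3) + 3 * s (h + 2) + s (h + 1))
        - 3 * (3 * s (h + 2) + 3 * s (h + 1) + s h)
        + ((3 * s (h + 1) + 3 * s h + s (h - 1)) + (3 * s (h + 1) - s (h - 1)))"
      by (rule dvd_add[OF dvd_diff[OF dvd_mult[OF C2] dvd_mult[OF C1]] dvd_add[OF C0 R1]])
    hence "int p dvd 9 * s (h + 3)" by (simp add: algebra_simps)
    hence z1: "int p dvd s (h + 3)" using n9 by blast
    have "int p dvd 27 * s (h + 3) - s (h - 3)" using refl[of 3] h by simp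
    hence z2: "int p dvd s (h - 3)" using z1 by (metis dvd_diff_right_iff dvd_mult)
    show ?thesis
      by (rule dvd_Dp_minus_of_two_zeros[OF p(1) p3 z2[unfolded s_def] z1[unfolded s_def]])
         (use h in auto)
  next
    case False
    hence e: "int p dvd 3 ^ (h - 1) - (-1)"
      using power_half_dichotomy[OF p(1) h(1) _ n3] h by auto
    \<comment> \<open>The recurrence at \<open>h + 4\<close> needs \<open>h + 4 < 2 * h - 2\<close>,
      which fails at \<open>h = 6\<close>.\<close>
    have "p \<noteq> 11"
    proof
      assume "p = 11"
      hence "h = 6" using h by simp
      thus False using e \<open>p = 11\<close> by simp
    qed
    hence h9: "h \<ge> 9" using p(2,3) \<open>odd p\<close> unfolding h_def by presburger
    have "int p dvd (-1) * 3 ^ 0 * s (h + 0) - s (h - 0)"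
      unfolding s_def by (rule quad_moment_reflect_center[OF p(1) h(1) n3 _ e]) (use h in auto)
    hence "int p dvd 2 * s h" by (simp add: dvd_diff_commute)
    hence z1: "int p dvd s h" using pp n2 by (simp add: prime_dvd_mult_iff)
    have C: "int p dvd 3 * s (h + 2) + 3 * s (h + 1) + s h"
      "int p dvd 3 * s (h + 3) + 3 * s (h + 2) + s (h + 1)"
      "int p dvd 3 * s (h + 4) + 3 * s (h + 3) + s (h + 2)"
      "int p dvd 3 * s (h + 5) + 3 * s (h + 4) + s (h + 3)"
      "int p dvd 3 * s (h + 6) + 3 * s (h + 5) + s (h + 4)"
      using rec[of h] rec[of "h + 1"] rec[of "h + 2"] rec[of "h + 3"] rec[of "h + 4"] h h9
      by (simp_all add: eval_nat_numeral)
    \<comment> \<open>\<open>27 X^6 + 1 = (3 X\<^sup>2 + 3 X + 1) (9 X^4 - 9 X^3 + 6 X\<^sup>2 - 3 X + 1)\<close>\<close>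
    have "int p dvd 9 * (3 * s (h + 6) + 3 * s (h + 5) + s (h + 4))
        - 9 * (3 * s (h + 5) + 3 * s (h + 4) + s (h + 3))
        + 6 * (3 * s (h + 4) + 3 * s (h + 3) + s (h + 2))
        - 3 * (3 * s (h + 3) + 3 * s (h + 2) + s (h + 1))
        + (3 * s (h + 2) + 3 * s (h + 1) + s h) - s h"
      by (rule dvd_diff[OF dvd_add[OF dvd_diff[OF dvd_add[OF dvd_diff[OF dvd_mult[OF C(5)]
            dvd_mult[OF C(4)]] dvd_mult[OF C(3)]] dvd_mult[OF C(2)]] C(1)] z1])
    hence "int p dvd 9 * (3 * s (h + 6))" by (simp add: algebra_simps)
    hence "int p dvd 3 * s (h + 6)" using n9 by blast
    hence z2: "int p dvd s (h + 6)" using pp n3 by (simp add: prime_dvd_mult_iff)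
    show ?thesis
      by (rule dvd_Dp_minus_of_two_zeros[OF p(1) p3 z1[unfolded s_def] z2[unfolded s_def]])
         (use h h9 in auto)
  qed
qed

text \<open>The roots of \<open>X^2 + 3 X + 1\<close> are \<open>-phi^2\<close> and
  \<open>-phi^(-2)\<close> for the golden ratio \<open>phi\<close>, which is why even-indexed Lucas
  numbers appear. The zeros used are \<open>h - g\<close> and \<open>h + g\<close> with
  \<open>h = 2 * g\<close>.\<close>

lemma dvd_Dp_minus_3_1:
  assumes p: "prime p" "p > 3" "p mod 4 = 3" "p mod 5 = 2 \<or> p mod 5 = 3"
  shows "int p dvd Dp_minus p 3 1"
proof -
  define s where "s = quad_moment p 3 1"
  define g where "g = (p + 1) div 4"
  define h where "h = 2 * g"
  have "p = 4 * (p div 4) + 3" "g = p div 4 + 1"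
    using p(3) unfolding g_def by presburger+
  hence h: "p = 2 * h - 1" "g \<ge> 2" using p(2) unfolding h_def by linarith+
  have pp: "prime (int p)" using p by simp
  have n2: "\<not> int p dvd 2" using p(2) zdvd_imp_le by fastforce
  have n1: "\<not> int p dvd 1" using p(2) by simp
  have rec: "int p dvd s (m + 2) + 3 * s (m + 1) + s m" if "0 < m" "m < p - 1" for m
    using quad_moment_rec[OF p(1) no_root_3_1[OF p(1) _ p(4)] that] p(2) by (simp add: s_def)
  have refl: "int p dvd s (h + k) - s (h - k)" if "k < h" for k
    using quad_moment_reflect_center[OF p(1) h(1) n1 that, of 1] by (simp add: s_def)
  \<comment> \<open>The Fibonacci expression is the Lucas number \<open>L (2 n)\<close>; the factor
    2 on the left matches \<open>L 0 = 2\<close>.\<close>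
  have lucas: "int p dvd 2 * s (h + n)
      - (-1) ^ n * (2 * int (fib (Suc (2 * n))) - int (fib (2 * n))) * s h" if "n < h" for n
    using that
  proof (induction n rule: less_induct)
    case (less n)
    consider "n = 0" | "n = 1" | k where "n = k + 2"
      by (metis One_nat_def add_2_eq_Suc' not0_implies_Suc)
    thus ?case
    proof cases
      case 2
      have hm: "h - 1 + 2 = h + 1" "h - 1 + 1 = h" using h h_def by auto
      have "int p dvd s (h + 1) + 3 * s h + s (h - 1)"
        using rec[of "h - 1"] h h_def unfolding hm by simp
      moreover have "int p dvd s (h + 1) - s (h - 1)" using refl[of 1] h h_def by simp
      ultimately have "int p dvd (s (h + 1) + 3 * s h + s (h - 1)) + (s (h + 1) - s (h - 1))"
        by (rule dvd_add)
      thus ?thesis by (simp add: 2 eval_nat_numeral algebra_simps)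
    next
      case 3
      let ?l = "\<lambda>n. 2 * int (fib (Suc (2 * n))) - int (fib (2 * n))"
      \<comment> \<open>The alternating sign in \<open>lucas\<close> turns this recurrence into the
        one for \<open>s\<close>.\<close>
      have l: "?l (k + 2) = 3 * ?l (k + 1) - ?l k" by (simp add: eval_nat_numeral)
      have "int p dvd 2 * (s (h + k + 2) + 3 * s (h + k + 1) + s (h + k))
          - 3 * (2 * s (h + (k + 1)) - (-1) ^ (k + 1) * ?l (k + 1) * s h)
          - (2 * s (h + k) - (-1) ^ k * ?l k * s h)"
      proof (intro dvd_diff[OF dvd_diff[OF dvd_mult dvd_mult]])
        show "int p dvd s (h + k + 2) + 3 * s (h + k + 1) + s (h + k)"
          using less.prems 3 h(1) by (intro rec) auto
        show "int p dvd 2 * s (h + (k + 1)) - (-1) ^ (k + 1) * ?l (k + 1) * s h"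
          using less.prems 3 by (intro less.IH) auto
        show "int p dvd 2 * s (h + k) - (-1) ^ k * ?l k * s h"
          using less.prems 3 by (intro less.IH) auto
      qed
      also have "\<dots> = 2 * s (h + (k + 2)) - (-1) ^ (k + 2) * ?l (k + 2) * s h"
        unfolding l by (simp add: algebra_simps)
      finally show ?thesis by (simp only: 3)
    qed simp
  qed
  have "int p dvd 2 * s (h + g) - (-1) ^ g * (2 * int (fib (Suc h)) - int (fib h)) * s h"
    using lucas[of g] h by (simp add: h_def)
  moreover have "int p dvd (-1) ^ g * (2 * int (fib (Suc h)) - int (fib h)) * s h"
    using prime_dvd_Lucas[OF p(1) h(1) _ _ p(4)] h(2) by (intro dvd_mult2 dvd_mult) (simp add: h_def)
  ultimately have "int p dvd 2 * s (h + g)" by (metis dvd_diff_left_iff)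
  hence z1: "int p dvd s (h + g)" using pp n2 by (simp add: prime_dvd_mult_iff)
  have "int p dvd s (h + g) - s (h - g)" using refl[of g] h by (simp add: h_def)
  hence z2: "int p dvd s (h - g)" using z1 by (metis dvd_diff_right_iff)
  show ?thesis
    by (rule dvd_Dp_minus_of_two_zeros[OF p(1,2) z2[unfolded s_def] z1[unfolded s_def]])
       (use h in \<open>auto simp: h_def\<close>)
qed

theorem theorem1p1:
  fixes p :: nat
  assumes "prime p" and "p > 3"
  shows "(p mod 8 = 7 \<longrightarrow> int p dvd Dp_minus p 2 2)
       \<and> (p > 5 \<and> p mod 3 = 2 \<longrightarrow> int p dvd Dp_minus p 3 3)
       \<and> (p mod 20 = 3 \<or> p mod 20 = 7 \<longrightarrow> int p dvd Dp_minus p 3 1)"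
proof (intro conjI impI)
  show "int p dvd Dp_minus p 2 2" if "p mod 8 = 7"
    using dvd_Dp_minus_2_2 assms that by blast
  show "int p dvd Dp_minus p 3 3" if "p > 5 \<and> p mod 3 = 2"
    using dvd_Dp_minus_3_3 assms that by blast
  show "int p dvd Dp_minus p 3 1" if "p mod 20 = 3 \<or> p mod 20 = 7"
  proof -
    have "p mod 4 = 3" "p mod 5 = 2 \<or> p mod 5 = 3" using that by presburger+
    thus ?thesis using dvd_Dp_minus_3_1 assms by blast
  qed
qed

end
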